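(* Let $(x^k)_{k\in\mathbb{N}}$ and $(\beta_k)_{k\in\mathbb{N}}$ be the sequences generated by Method 2. Suppose that $S_*\neq\emptyset$ and that there is some $\beta>0$ such that $\beta_k\ge\beta$ for all $k\in\mathbb{N}$. Then for all integers $k\ge1$, $$(f+g)(x^k)-\min_{x\in\mathcal{H}}(f+g)(x)\le\frac{1}{2\beta}\,\frac{[\operatorname{dist}(x^0,S_* )]^2+2\big[(f+g)(x^0)-\min_{x\in\mathcal{H}}(f+g)(x)\big]}{k}.$$ If in addition $\dim\mathcal{H}<+\infty$, then $$\lim_{k\to\infty}k\Big[(f+g)(x^k)-\min_{x\in\mathcal{H}}(f+g)(x)\Big]=0.$$
   Context: Let $\mathcal{H}$ be a real Hilbert space with inner product $\langle\cdot,\cdot\rangle$ and induced norm $\|\cdot\|$; $\overline{\mathbb{R}}:=\mathbb{R}\cup\{+\infty\}$ and $\operatorname{dom}h:=\{x\in\mathcal{H}: h(x)<+\infty\}$. Standing assumptions. (A1) $f,g:\mathcal{H}\to\overline{\mathbb{R}}$ are proper lower semicontinuous convex functions with $\operatorname{dom}g\subseteq\operatorname{dom}f$. (A2) $f$ is Fréchet differentiable on an open set containing $\operatorname{dom}g$; its gradient $\nabla f$ is uniformly continuous on any bounded subset of $\operatorname{dom}g$ and maps any bounded subset of $\operatorname{dom}g$ to a bounded set in $\mathcal{H}$. $S_*$ denotes the set of minimizers of $f+g$ over $\mathcal{H}$, and $\operatorname{dist}(x,S):=\inf_{y\in S}\|x-y\|$. The proximal operator is $\operatorname{prox}_{g}:=(\mathrm{Id}+\partial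 g)^{-1}$, which is single-valued and defined on all of $\mathcal{H}$ with values in $\operatorname{dom}g$. Linesearch 2 $(x,\theta)$, for $x\in\operatorname{dom}g$, $\theta\in(0,1)$: set $\beta=1$ and $J_x:=\operatorname{prox}_g(x-\nabla f(x))$; while $$(f+g)(x-\beta(x-J_x))>(f+g)(x)-\beta[g(x)-g(J_x)]-\beta\langle\nabla f(x),x-J_x\rangle+\tfrac{\beta}{2}\|x-J_x\|^2,$$ replace $\beta$ by $\theta\beta$; output $\beta$. Method 2: choose $x^0\in\operatorname{dom}g$ and $\theta\in(0,1)$. For $k=0,1,2,\dots$ set $J_k=\operatorname{prox}_g(x^k-\nabla f(x^k))$ and $x^{k+1}=x^k-\beta_k(x^k-J_k)$, where $\beta_k$ is the output of Linesearch 2 $(x^k,\theta)$; the stop criterion is $x^{k+1}=x^k$. The statement concerns the infinite sequences $(x^k)_{k\in\mathbb{N}}$, $(\beta_k)_{k\in\mathbb{N}}$ so generated. *)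

theory Defs
  imports "HOL-Analysis.Analysis" "HOL-Library.While_Combinator"
begin

text \<open>
  Functions with values in \<open>\<real> \<union> {+\<infinity>}\<close> are functions into \<^typ>\<open>ereal\<close>; the value \<open>-\<infinity>\<close>
  is excluded by properness.  Hilbert spaces are types of sort \<open>{real_inner, complete_space}\<close>.
\<close>

definition edom :: "('a \<Rightarrow> ereal) \<Rightarrow> 'a set" where
  "edom h = {x. h x < \<infinity>}"

definition eproper :: "('a \<Rightarrow> ereal) \<Rightarrow> bool" where
  "eproper h \<longleftrightarrow> (\<forall>x. h x \<noteq> -\<infinity>) \<and> edom h \<noteq> {}"

definition lower_semicont :: "('a::topological_space \<Rightarrow> ereal) \<Rightarrow> bool" where
  "lower_semicont h \<longleftrightarrow> (\<forall>x. h x \<le> Liminf (at x) h)"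

definition econvex :: "('a::real_vector \<Rightarrow> ereal) \<Rightarrow> bool" where
  "econvex h \<longleftrightarrow>
     (\<forall>x y. \<forall>t\<in>{0<..<1::real}.
        h ((1 - t) *\<^sub>R x + t *\<^sub>R y) \<le> ereal (1 - t) * h x + ereal t * h y)"

definition frechet_differentiable_on_open :: "('a::real_normed_vector \<Rightarrow> ereal) \<Rightarrow> 'a set \<Rightarrow> bool" where
  "frechet_differentiable_on_open f U \<longleftrightarrow>
     open U \<and> U \<subseteq> edom f \<and> (\<forall>x\<in>U. (\<lambda>y. real_of_ereal (f y)) differentiable (at x))"

text \<open>
  Meaningful where \<open>f\<close> is finite and Frechet differentiable; there the derivative is
  represented by a unique vector (Riesz).
\<close>

definition gradient :: "('a::real_inner \<Rightarrow> ereal) \<Rightarrow> 'a \<Rightarrow> 'a" where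
  "gradient f x = (THE D. GDERIV (\<lambda>y. real_of_ereal (f y)) x :> D)"

definition subdiff :: "('a::real_inner \<Rightarrow> ereal) \<Rightarrow> 'a \<Rightarrow> 'a set" where
  "subdiff h x = {u. \<forall>y. h x + ereal (u \<bullet> (y - x)) \<le> h y}"

text \<open>
  The resolvent \<open>(Id + \<partial>h)\<^sup>-\<^sup>1\<close>: \<open>z \<in> p + \<partial>h p\<close>.  The description is proper because the
  resolvent of a proper lower semicontinuous convex function on a Hilbert space is
  single-valued and everywhere defined.
\<close>

definition prox :: "('a::real_inner \<Rightarrow> ereal) \<Rightarrow> 'a \<Rightarrow> 'a" where
  "prox h z = (THE p. z \<in> (\<lambda>u. p + u) ` subdiff h p)"

definition minimizers :: "('a \<Rightarrow> ereal) \<Rightarrow> 'a set" where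
  "minimizers h = {x. \<forall>y. h x \<le> h y}"

text \<open>The forward-backward point \<open>J\<^sub>x\<close>.\<close>

definition fb_point :: "('a::real_inner \<Rightarrow> ereal) \<Rightarrow> ('a \<Rightarrow> ereal) \<Rightarrow> 'a \<Rightarrow> 'a" where
  "fb_point f g x = prox g (x - gradient f x)"

text \<open>
  The loop condition of the linesearch.  For \<open>x \<in> edom g\<close> all terms on the right-hand side
  are finite, so no indeterminate difference of infinities occurs.
\<close>

definition linesearch2_continue ::
    "('a::real_inner \<Rightarrow> ereal) \<Rightarrow> ('a \<Rightarrow> ereal) \<Rightarrow> 'a \<Rightarrow> real \<Rightarrow> bool" where
  "linesearch2_continue f g x \<beta> \<longleftrightarrow>
     (let J = fb_point f g x; z = x - \<beta> *\<^sub>R (x - J)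
      in f z + g z >
           (f x + g x) - ereal \<beta> * (g x - g J)
             - ereal (\<beta> * (gradient f x \<bullet> (x - J)))
             + ereal (\<beta> / 2 * (norm (x - J))\<^sup>2))"

text \<open>The output of the while loop; \<^term>\<open>None\<close> stands for non-termination.\<close>

definition linesearch2 ::
    "('a::real_inner \<Rightarrow> ereal) \<Rightarrow> ('a \<Rightarrow> ereal) \<Rightarrow> 'a \<Rightarrow> real \<Rightarrow> real option" where
  "linesearch2 f g x \<theta> = while_option (linesearch2_continue f g x) (\<lambda>\<beta>. \<theta> * \<beta>) 1"

text \<open>
  Infinite runs.  If the stop criterion \<open>x (Suc k) = x k\<close> is ever met, the run is
  continued by the same recursion.
\<close>

definition method2 ::
    "('a::real_inner \<Rightarrow> ereal) \<Rightarrow> ('a \<Rightarrow> ereal) \<Rightarrow> real \<Rightarrow> (nat \<Rightarrow> 'a) \<Rightarrow> (nat \<Rightarrow> real) \<Rightarrow> bool" where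
  "method2 f g \<theta> x \<beta> \<longleftrightarrow>
     x 0 \<in> edom g \<and> \<theta> \<in> {0<..<1} \<and>
     (\<forall>k. linesearch2 f g (x k) \<theta> = Some (\<beta> k) \<and>
          x (Suc k) = x k - \<beta> k *\<^sub>R (x k - fb_point f g (x k)))"

end

theory Submission
  imports Defs
begin

text \<open>
  Write \<open>F = f + g\<close>.  Adding the prox inclusion, the gradient inequality for \<open>f\<close> and the exit
  condition of the linesearch gives, for every \<open>y\<close> in the domain of \<open>g\<close>,
  \<open>2 (F x\<^sub>k\<^sub>+\<^sub>1 - F x\<^sub>k) + 2 \<beta>\<^sub>k (F x\<^sub>k - F y) \<le> \<parallel>x\<^sub>k - y\<parallel>\<^sup>2 - \<parallel>x\<^sub>k\<^sub>+\<^sub>1 - y\<parallel>\<^sup>2\<close>.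
  With \<open>y = x\<^sub>k\<close> this shows that \<open>F x\<^sub>k\<close> decreases; with \<open>y\<close> a minimizer it telescopes, so the
  gaps \<open>F x\<^sub>k - min F\<close> are summable with an explicit bound.  A decreasing summable sequence
  is \<open>o(1/k)\<close>, which is the second claim.  Existence of proximal points
  comes from completeness: a minimizing sequence of \<open>g + \<parallel>\<cdot> - z\<parallel>\<^sup>2 / 2\<close> is Cauchy by the
  parallelogram law.
\<close>

section \<open>Convexity and lower semicontinuity for extended-real values\<close>

lemma eproper_ereal_real:
  assumes "eproper h" "x \<in> edom h"
  shows "h x = ereal (real_of_ereal (h x))"
  using assms by (cases "h x") (auto simp: eproper_def edom_def)

lemma edomI: "h x \<le> ereal c \<Longrightarrow> x \<in> edom h"
  unfolding edom_def by (auto simp: le_less_trans)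

lemma econvex_segment:
  fixes h :: "'a::real_vector \<Rightarrow> ereal"
  assumes "eproper h" "econvex h" "x \<in> edom h" "y \<in> edom h" "0 \<le> t" "t \<le> 1"
  shows "(1 - t) *\<^sub>R x + t *\<^sub>R y \<in> edom h"
    and "real_of_ereal (h ((1 - t) *\<^sub>R x + t *\<^sub>R y))
           \<le> (1 - t) * real_of_ereal (h x) + t * real_of_ereal (h y)"
proof -
  have "(1 - t) *\<^sub>R x + t *\<^sub>R y \<in> edom h \<and>
      real_of_ereal (h ((1 - t) *\<^sub>R x + t *\<^sub>R y))
        \<le> (1 - t) * real_of_ereal (h x) + t * real_of_ereal (h y)"
  proof (cases "t = 0 \<or> t = 1")
    case True
    then show ?thesis using assms by auto
  next
    case False
    let ?z = "(1 - t) *\<^sub>R x + t *\<^sub>R y"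
    have "t \<in> {0<..<1}" using False assms by auto
    then have "h ?z \<le> ereal (1 - t) * h x + ereal t * h y"
      using assms(2) unfolding econvex_def by blast
    also have "\<dots> = ereal ((1 - t) * real_of_ereal (h x) + t * real_of_ereal (h y))"
      using eproper_ereal_real[OF assms(1,3)] eproper_ereal_real[OF assms(1,4)]
      by (metis plus_ereal.simps(1) times_ereal.simps(1))
    finally have le: "h ?z \<le> ereal ((1 - t) * real_of_ereal (h x) + t * real_of_ereal (h y))" .
    then have z: "?z \<in> edom h" by (rule edomI)
    then show ?thesis using le eproper_ereal_real[OF assms(1) z] by (metis ereal_less_eq(3))
  qed
  then show "(1 - t) *\<^sub>R x + t *\<^sub>R y \<in> edom h"
    and "real_of_ereal (h ((1 - t) *\<^sub>R x + t *\<^sub>R y))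
           \<le> (1 - t) * real_of_ereal (h x) + t * real_of_ereal (h y)" by auto
qed

text \<open>The \<open>Liminf\<close> along \<open>at x\<close> ignores \<open>x\<close> itself, so
  it only controls a punctured neighbourhood; the assumption supplies the missing centre.\<close>

lemma lower_semicont_eventually:
  assumes "lower_semicont h" "c < h x"
  shows "\<forall>\<^sub>F y in nhds x. c < h y"
proof -
  have "h x \<le> Liminf (at x) h" using assms unfolding lower_semicont_def by auto
  then have "\<forall>\<^sub>F y in at x. c < h y"
    using assms(2) by (simp add: le_Liminf_iff)
  then show ?thesis
    using assms(2) unfolding eventually_nhds_conv_at by simp
qed

text \<open>Lower semicontinuity at one point bounds \<^term>\<open>h\<close> below on a small ball; convexity along
  rays from the centre propagates the bound.\<close>

lemma convex_lsc_lower_bound: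
  fixes h :: "'a::real_inner \<Rightarrow> ereal"
  assumes "eproper h" "lower_semicont h" "econvex h"
  obtains x0 a L where "x0 \<in> edom h" "L \<ge> 0"
    "\<And>y. y \<in> edom h \<Longrightarrow> real_of_ereal (h y) \<ge> a - L * norm (y - x0)"
proof -
  obtain x0 where x0: "x0 \<in> edom h" using assms(1) unfolding eproper_def by blast
  define a where "a = real_of_ereal (h x0)"
  have hx0: "h x0 = ereal a" using eproper_ereal_real[OF assms(1) x0] by (simp add: a_def)
  have "ereal (a - 1) < h x0" by (simp add: hx0)
  from lower_semicont_eventually[OF assms(2) this]
  obtain d0 where d0: "d0 > 0" "\<And>y. dist y x0 < d0 \<Longrightarrow> ereal (a - 1) < h y"
    unfolding eventually_nhds_metric by blast
  define d where "d = d0 / 2"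
  have d: "d > 0" "\<And>y. norm (y - x0) \<le> d \<Longrightarrow> ereal (a - 1) < h y"
    using d0 by (auto simp: d_def dist_norm)
  have "real_of_ereal (h y) \<ge> (a - 1) - (1 / d) * norm (y - x0)" if y: "y \<in> edom h" for y
  proof (cases "norm (y - x0) \<le> d")
    case True
    then have "a - 1 < real_of_ereal (h y)"
      using d(2)[OF True] eproper_ereal_real[OF assms(1) y] by (metis less_ereal.simps(1))
    moreover have "(1 / d) * norm (y - x0) \<ge> 0" using d by simp
    ultimately show ?thesis by linarith
  next
    case False
    define r where "r = norm (y - x0)"
    \<comment> \<open>This puts \<open>?w\<close> on the segment from \<open>x0\<close> to
      \<open>y\<close> at distance exactly \<open>d\<close> from \<open>x0\<close>, where the local
      bound still holds. Convexity then turns it into a bound at \<open>y\<close>.\<close>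
    define t where "t = d / r"
    have r: "r > d" "r > 0" using False d by (auto simp: r_def)
    have t: "0 < t" "t \<le> 1" using r d by (auto simp: t_def)
    let ?w = "(1 - t) *\<^sub>R x0 + t *\<^sub>R y"
    have "?w - x0 = t *\<^sub>R (y - x0)" by (simp add: algebra_simps)
    then have "norm (?w - x0) = t * r" using t by (simp add: r_def)
    then have "norm (?w - x0) \<le> d" using r by (simp add: t_def)
    from d(2)[OF this] have "a - 1 < real_of_ereal (h ?w)"
      using eproper_ereal_real[OF assms(1) econvex_segment(1)[OF assms(1,3) x0 y, of t]] t
      by (metis less_eq_real_def less_ereal.simps(1))
    also have "\<dots> \<le> (1 - t) * a + t * real_of_ereal (h y)"
      using econvex_segment(2)[OF assms(1,3) x0 y, of t] t by (simp add: a_def)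
    finally have "t * (a - real_of_ereal (h y)) < 1" by (simp add: algebra_simps)
    then have "a - real_of_ereal (h y) < 1 / t" using t by (simp add: field_simps)
    then show ?thesis using r d by (simp add: t_def r_def)
  qed
  then show ?thesis using that[OF x0, of "1 / d" "a - 1"] d by auto
qed

section \<open>Proximal points and the subdifferential\<close>

lemma parallelogram_law:
  fixes x y :: "'a::real_inner"
  shows "(norm (x + y))\<^sup>2 + (norm (x - y))\<^sup>2 = 2 * (norm x)\<^sup>2 + 2 * (norm y)\<^sup>2"
  by (simp add: power2_norm_eq_inner inner_add_left inner_add_right inner_diff_left inner_diff_right)

lemma prox_minimizer_exists:
  fixes h :: "'a::{real_inner, complete_space} \<Rightarrow> ereal"
  assumes "eproper h" "lower_semicont h" "econvex h"
  obtains p where "p \<in> edom h"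
    "\<And>y. y \<in> edom h \<Longrightarrow> real_of_ereal (h p) + (norm (p - z))\<^sup>2 / 2
             \<le> real_of_ereal (h y) + (norm (y - z))\<^sup>2 / 2"
proof -
  define \<phi> where "\<phi> y = real_of_ereal (h y) + (norm (y - z))\<^sup>2 / 2" for y
  obtain x0 a L where x0: "x0 \<in> edom h" and L: "L \<ge> 0"
    and lb: "\<And>y. y \<in> edom h \<Longrightarrow> real_of_ereal (h y) \<ge> a - L * norm (y - x0)"
    using convex_lsc_lower_bound[OF assms] by metis
  have lb\<phi>: "\<phi> y \<ge> a - L * norm (x0 - z) - L\<^sup>2 / 2" if "y \<in> edom h" for y
  proof -
    have "norm (y - x0) \<le> norm (y - z) + norm (x0 - z)"
      using norm_triangle_ineq4[of "y - z" "x0 - z"] by simp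
    then have "L * norm (y - x0) \<le> L * norm (y - z) + L * norm (x0 - z)"
      using L by (metis distrib_left mult_left_mono)
    \<comment> \<open>Young's inequality: half the squared distance absorbs the linear decay allowed
      by \<open>lb\<close>, so the infimum below is finite.\<close>
    moreover have "0 \<le> (norm (y - z) - L)\<^sup>2" by simp
    then have "L * norm (y - z) \<le> (norm (y - z))\<^sup>2 / 2 + L\<^sup>2 / 2"
      by (simp add: power2_diff algebra_simps)
    ultimately show ?thesis using lb[OF that] unfolding \<phi>_def by linarith
  qed
  \<comment> \<open>The infimum runs over \<open>edom h\<close> only: where \<open>h\<close> is
    infinite, \<open>real_of_ereal\<close> returns the default 0 and \<phi> has no meaning.\<close>
  define m where "m = (INF y\<in>edom h. \<phi> y)"
  have bdd: "bdd_below (\<phi> ` edom h)" using lb\<phi> by (auto intro!: bdd_belowI2)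
  have m_le: "m \<le> \<phi> y" if "y \<in> edom h" for y
    unfolding m_def by (rule cINF_lower[OF bdd that])
  have "\<exists>y\<in>edom h. \<phi> y < m + 1 / real (Suc n)" for n
  proof -
    have "m < m + 1 / real (Suc n)" by simp
    then show ?thesis unfolding m_def using x0 bdd by (subst (asm) cINF_less_iff) auto
  qed
  then obtain q where q: "\<And>n. q n \<in> edom h" "\<And>n. \<phi> (q n) < m + 1 / real (Suc n)" by metis
  \<comment> \<open>Strong convexity of the quadratic term: the value at the midpoint lies below the
    average by an eighth of the squared distance, yet is still at least \<open>m\<close>.\<close>
  have par: "(norm (y - w))\<^sup>2 \<le> 4 * (\<phi> y + \<phi> w - 2 * m)" if "y \<in> edom h" "w \<in> edom h" for y w
  proof -
    let ?c = "(1 - 1/2) *\<^sub>R y + (1/2::real) *\<^sub>R w"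
    have c: "?c \<in> edom h"
      "real_of_ereal (h ?c) \<le> (1 - 1/2) * real_of_ereal (h y) + 1/2 * real_of_ereal (h w)"
      by (rule econvex_segment[OF assms(1,3) that]; simp)+
    have "(norm (?c - z))\<^sup>2
        = (norm (y - z))\<^sup>2 / 2 + (norm (w - z))\<^sup>2 / 2 - (norm (y - w))\<^sup>2 / 4"
    proof -
      have "?c - z = (1/2) *\<^sub>R ((y - z) + (w - z))" "y - w = (y - z) - (w - z)"
        by (simp_all add: algebra_simps flip: scaleR_add_left)
      then show ?thesis
        using parallelogram_law[of "y - z" "w - z"] by (simp add: power_mult_distrib power2_eq_square)
    qed
    then have "\<phi> ?c \<le> \<phi> y / 2 + \<phi> w / 2 - (norm (y - w))\<^sup>2 / 8"
      using c(2) unfolding \<phi>_def by (simp add: field_simps)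
    then show ?thesis using m_le[OF c(1)] by simp
  qed
  have "Cauchy q"
  proof (rule metric_CauchyI)
    fix e :: real assume e: "e > 0"
    \<comment> \<open>Both values exceed \<open>m\<close> by less than \<open>1 / N\<close>, so
      \<open>par\<close> gives \<open>4 * (1/N + 1/N) = 8 / N\<close>, which has to be below the
      square of \<open>e\<close>.\<close>
    obtain N where N: "real N > 8 / e\<^sup>2" using reals_Archimedean2 by blast
    have "N > 0" using N e by (metis divide_pos_pos gr0I not_less_iff_gr_or_eq of_nat_0
        zero_less_numeral zero_less_power)
    show "\<exists>M. \<forall>i\<ge>M. \<forall>j\<ge>M. dist (q i) (q j) < e"
    proof (intro exI allI impI)
      fix i j assume ij: "i \<ge> N" "j \<ge> N"
      have "1 / real (Suc i) \<le> 1 / real N" "1 / real (Suc j) \<le> 1 / real N"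
        using ij \<open>N > 0\<close> by (auto intro!: divide_left_mono)
      then have "(norm (q i - q j))\<^sup>2 < 8 / real N"
        using par[OF q(1) q(1), of i j] q(2)[of i] q(2)[of j] by simp
      also have "\<dots> < e\<^sup>2" using N e \<open>N > 0\<close> by (simp add: field_simps)
      finally show "dist (q i) (q j) < e"
        using e by (simp add: dist_norm power_less_imp_less_base)
    qed
  qed
  then obtain p where p: "q \<longlonglongrightarrow> p" using Cauchy_convergent convergent_def by blast
  \<comment> \<open>It is not yet known that \<open>h p\<close> is finite, so the limit passage uses
    real numbers \<open>c\<close> below \<open>h p\<close>. Density then bounds \<open>h p\<close>
    itself, and finiteness follows.\<close>
  have "c \<le> m - (norm (p - z))\<^sup>2 / 2" if c: "ereal c < h p" for c
  proof -
    have ev: "\<forall>\<^sub>F n in sequentially. ereal c < h (q n)"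
      using lower_semicont_eventually[OF assms(2) c] p by (rule eventually_compose_filterlim)
    have "\<forall>\<^sub>F n in sequentially. c + (norm (q n - z))\<^sup>2 / 2 \<le> m + 1 / real (Suc n)"
    proof (rule eventually_mono[OF ev])
      fix n assume "ereal c < h (q n)"
      then have "c < real_of_ereal (h (q n))"
        using eproper_ereal_real[OF assms(1) q(1)[of n]] by (metis less_ereal.simps(1))
      then show "c + (norm (q n - z))\<^sup>2 / 2 \<le> m + 1 / real (Suc n)"
        using q(2)[of n] unfolding \<phi>_def by simp
    qed
    moreover have "(\<lambda>n. c + (norm (q n - z))\<^sup>2 / 2) \<longlonglongrightarrow> c + (norm (p - z))\<^sup>2 / 2"
      by (intro tendsto_intros p) simp
    moreover have "(\<lambda>n. m + 1 / real (Suc n)) \<longlonglongrightarrow> m + 0"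
      by (intro tendsto_intros LIMSEQ_inverse_real_of_nat[unfolded inverse_eq_divide])
    ultimately have "c + (norm (p - z))\<^sup>2 / 2 \<le> m + 0"
      by - (rule tendsto_le[OF sequentially_bot])
    then show ?thesis by simp
  qed
  then have hp: "h p \<le> ereal (m - (norm (p - z))\<^sup>2 / 2)"
    by (meson ereal_dense2 ereal_less(2) ereal_less_eq(3) not_less order_less_le_trans)
  then have p_dom: "p \<in> edom h" by (rule edomI)
  have "real_of_ereal (h p) \<le> m - (norm (p - z))\<^sup>2 / 2"
    using hp eproper_ereal_real[OF assms(1) p_dom] by (metis ereal_less_eq(3))
  then have "\<phi> p \<le> \<phi> y" if "y \<in> edom h" for y
    using m_le[OF that] unfolding \<phi>_def by simp
  then show ?thesis using that[OF p_dom] unfolding \<phi>_def by blast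
qed

text \<open>Let \<open>t\<close> tend to 0 from the right. This removes the second-order remainder
  in the optimality condition below.\<close>

lemma le_if_le_add_small_mult:
  fixes a b c :: real
  assumes "\<And>t. 0 < t \<Longrightarrow> t < 1 \<Longrightarrow> a \<le> b + t * c"
  shows "a \<le> b"
proof (rule tendsto_lowerbound)
  have "((\<lambda>t. b + t * c) \<longlongrightarrow> b + 0 * c) (at_right 0)" by (intro tendsto_intros)
  then show "((\<lambda>t. b + t * c) \<longlongrightarrow> b) (at_right 0)" by simp
  show "\<forall>\<^sub>F t in at_right 0. a \<le> b + t * c"
    by (rule eventually_mono[OF eventually_at_right_real[of 0 1]]) (use assms in auto)
qed simp

text \<open>First-order optimality: the minimizer \<open>p\<close> is compared with points on the
  segment from \<open>p\<close> to \<open>y\<close>. Convexity bounds \<open>h\<close> there;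
  dividing by \<open>t\<close> and letting \<open>t\<close> tend to 0 leaves the subgradient
  inequality.\<close>

lemma prox_subdiff_exists:
  fixes h :: "'a::{real_inner, complete_space} \<Rightarrow> ereal"
  assumes "eproper h" "lower_semicont h" "econvex h"
  obtains p where "z - p \<in> subdiff h p"
proof -
  obtain p where p: "p \<in> edom h"
    and min: "\<And>y. y \<in> edom h \<Longrightarrow> real_of_ereal (h p) + (norm (p - z))\<^sup>2 / 2
             \<le> real_of_ereal (h y) + (norm (y - z))\<^sup>2 / 2"
    using prox_minimizer_exists[OF assms] by metis
  have "h p + ereal ((z - p) \<bullet> (y - p)) \<le> h y" for y
  proof (cases "y \<in> edom h")
    case False
    then show ?thesis by (simp add: edom_def)
  next
    case y: True
    have "real_of_ereal (h p) + (z - p) \<bullet> (y - p)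
        \<le> real_of_ereal (h y) + t * ((norm (y - p))\<^sup>2 / 2)" if t: "0 < t" "t < 1" for t
    proof -
      let ?w = "(1 - t) *\<^sub>R p + t *\<^sub>R y"
      have w: "?w \<in> edom h"
        "real_of_ereal (h ?w) \<le> (1 - t) * real_of_ereal (h p) + t * real_of_ereal (h y)"
        using t by (auto intro!: econvex_segment[OF assms(1,3) p y])
      have "(norm (?w - z))\<^sup>2
          = (norm (p - z))\<^sup>2 - 2 * t * ((z - p) \<bullet> (y - p)) + t\<^sup>2 * (norm (y - p))\<^sup>2"
      proof -
        have "?w - z = (p - z) + t *\<^sub>R (y - p)" by (simp add: algebra_simps)
        then have "(norm (?w - z))\<^sup>2
            = (norm (p - z))\<^sup>2 + 2 * t * ((p - z) \<bullet> (y - p)) + t\<^sup>2 * (norm (y - p))\<^sup>2"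
          unfolding power2_norm_eq_inner
          by (simp only: inner_add_left inner_add_right inner_scaleR_left inner_scaleR_right
              inner_commute[of "y - p" "p - z"] power2_eq_square) (simp add: algebra_simps)
        then show ?thesis by (simp add: inner_diff_left right_diff_distrib)
      qed
      then have "t * (real_of_ereal (h p) + (z - p) \<bullet> (y - p))
          \<le> t * (real_of_ereal (h y) + t * ((norm (y - p))\<^sup>2 / 2))"
        using min[OF w(1)] w(2) by (simp add: algebra_simps power2_eq_square)
      then show ?thesis using t by simp
    qed
    then have "real_of_ereal (h p) + (z - p) \<bullet> (y - p) \<le> real_of_ereal (h y)"
      by (rule le_if_le_add_small_mult)
    then show ?thesis
      using eproper_ereal_real[OF assms(1) p] eproper_ereal_real[OF assms(1) y]
      by (metis ereal_less_eq(3) plus_ereal.simps(1))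
  qed
  then show ?thesis using that unfolding subdiff_def by blast
qed

text \<open>A subgradient inequality based at a point of value infinity would make \<open>h\<close>
  infinite everywhere, against properness.\<close>

lemma subdiff_edom:
  assumes "eproper h" "u \<in> subdiff h p"
  shows "p \<in> edom h"
proof (rule ccontr)
  obtain y where y: "y \<in> edom h" using assms(1) unfolding eproper_def by blast
  assume "p \<notin> edom h"
  then have "h p = \<infinity>" by (simp add: edom_def)
  moreover have "h p + ereal (u \<bullet> (y - p)) \<le> h y"
    using assms(2) by (simp add: subdiff_def)
  ultimately show False using y by (simp add: edom_def)
qed

lemma subdiff_real_le:
  assumes "eproper h" "u \<in> subdiff h p" "y \<in> edom h"
  shows "real_of_ereal (h p) + u \<bullet> (y - p) \<le> real_of_ereal (h y)"
proof -
  have "h p + ereal (u \<bullet> (y - p)) \<le> h y" using assms(2) by (simp add: subdiff_def)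
  then show ?thesis
    using eproper_ereal_real[OF assms(1) subdiff_edom[OF assms(1,2)]]
      eproper_ereal_real[OF assms(1,3)]
    by (metis ereal_less_eq(3) plus_ereal.simps(1))
qed

text \<open>Justifies the definite description in \<open>prox\<close>. Uniqueness is monotonicity of
  the subdifferential: adding the two subgradient inequalities, each tested at the other point,
  gives a nonpositive square.\<close>

lemma prox_subdiff:
  fixes h :: "'a::{real_inner, complete_space} \<Rightarrow> ereal"
  assumes "eproper h" "lower_semicont h" "econvex h"
  shows "z - prox h z \<in> subdiff h (prox h z)"
proof -
  have iff: "z \<in> (\<lambda>u. p + u) ` subdiff h p \<longleftrightarrow> z - p \<in> subdiff h p" for p
    by (auto simp: image_iff algebra_simps intro!: bexI[of _ "z - p"])
  have uniq: "p = q" if "z - p \<in> subdiff h p" "z - q \<in> subdiff h q" for p q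
  proof -
    have "real_of_ereal (h p) + (z - p) \<bullet> (q - p) \<le> real_of_ereal (h q)"
      "real_of_ereal (h q) + (z - q) \<bullet> (p - q) \<le> real_of_ereal (h p)"
      using that subdiff_real_le subdiff_edom assms(1) by blast+
    then have "(z - p) \<bullet> (q - p) + (z - q) \<bullet> (p - q) \<le> 0" by linarith
    then have "(q - p) \<bullet> (q - p) \<le> 0" by (simp add: algebra_simps inner_commute)
    then show ?thesis by (metis eq_iff_diff_eq_0 inner_eq_zero_iff inner_ge_zero order_antisym)
  qed
  obtain p where p: "z - p \<in> subdiff h p" using prox_subdiff_exists[OF assms] by metis
  have "prox h z = p"
    unfolding prox_def iff by (rule the_equality) (use p uniq in auto)
  then show ?thesis using p by simp
qed

text \<open>Riesz representation as a special case of the prox inclusion: for \<^term>\<open>\<phi>\<close> linear,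
  the proximal point of the origin is the negative of the representing vector.\<close>

lemma bounded_linear_representation:
  fixes \<phi> :: "'a::{real_inner, complete_space} \<Rightarrow> real"
  assumes "bounded_linear \<phi>"
  obtains D where "\<And>v. \<phi> v = v \<bullet> D"
proof -
  interpret bounded_linear \<phi> by fact
  let ?h = "\<lambda>y. ereal (\<phi> y)"
  have "lower_semicont ?h" unfolding lower_semicont_def
  proof
    fix x
    have "(?h \<longlongrightarrow> ?h x) (at x)" by (intro tendsto_intros tendsto tendsto_ident_at)
    then show "?h x \<le> Liminf (at x) ?h"
      by (metis lim_imp_Liminf Liminf_bot order_refl top_greatest)
  qed
  moreover have "eproper ?h" by (auto simp: eproper_def edom_def)
  moreover have "econvex ?h" by (auto simp: econvex_def add scaleR)
  ultimately obtain p where p: "0 - p \<in> subdiff ?h p" using prox_subdiff_exists by metis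
  \<comment> \<open>Testing the subgradient inequality at \<open>p + v\<close> cancels
    \<phi>\<open>p\<close> by linearity. Using this for both \<open>v\<close> and \<open>- v\<close>
    gives equality.\<close>
  have ge: "\<phi> v \<ge> - (p \<bullet> v)" for v
  proof -
    have "ereal (\<phi> p) + ereal ((0 - p) \<bullet> ((p + v) - p)) \<le> ereal (\<phi> (p + v))"
      using p unfolding subdiff_def by blast
    then show ?thesis by (simp add: add)
  qed
  have "\<phi> v = v \<bullet> (- p)" for v
    using ge[of v] ge[of "- v"] by (simp add: neg inner_commute)
  then show ?thesis using that by blast
qed

section \<open>Gradients of convex functions\<close>

text \<open>Justifies the definite description in \<open>gradient\<close>: the Riesz vector of the
  derivative exists, and uniqueness of the derivative, tested at \<open>D' - D\<close>, determines
  it.\<close>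

lemma GDERIV_gradient:
  fixes f :: "'a::{real_inner, complete_space} \<Rightarrow> ereal"
  assumes "(\<lambda>y. real_of_ereal (f y)) differentiable (at x)"
  shows "GDERIV (\<lambda>y. real_of_ereal (f y)) x :> gradient f x"
proof -
  let ?f = "\<lambda>y. real_of_ereal (f y)"
  obtain f' where f': "(?f has_derivative f') (at x)" using assms differentiable_def by blast
  obtain D where "\<And>v. f' v = v \<bullet> D"
    using bounded_linear_representation[OF has_derivative_bounded_linear[OF f']] by metis
  then have "f' = (\<lambda>v. v \<bullet> D)" by auto
  then have D: "GDERIV ?f x :> D" using f' by (simp add: gderiv_def)
  have "D' = D" if "GDERIV ?f x :> D'" for D'
  proof -
    have "(\<lambda>h. h \<bullet> D') = (\<lambda>h. h \<bullet> D)"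
      using has_derivative_unique D that unfolding gderiv_def by blast
    then have "(D' - D) \<bullet> D' = (D' - D) \<bullet> D" by metis
    then have "(D' - D) \<bullet> (D' - D) = 0" by (simp add: inner_diff_right)
    then show ?thesis by simp
  qed
  then show ?thesis unfolding gradient_def using D theI[of "\<lambda>D. GDERIV ?f x :> D"] by blast
qed

lemma gradient_inequality:
  fixes f :: "'a::{real_inner, complete_space} \<Rightarrow> ereal"
  assumes "eproper f" "econvex f" "x \<in> edom f" "y \<in> edom f"
    and "(\<lambda>y. real_of_ereal (f y)) differentiable (at x)"
  shows "real_of_ereal (f x) + gradient f x \<bullet> (y - x) \<le> real_of_ereal (f y)"
proof -
  define c where "c t = x + t *\<^sub>R (y - x)" for t
  let ?f = "\<lambda>y. real_of_ereal (f y)"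
  have "(?f has_derivative (\<lambda>h. h \<bullet> gradient f x)) (at (c 0))"
    using GDERIV_gradient[OF assms(5)] by (simp add: gderiv_def c_def)
  moreover have "(c has_derivative (\<lambda>t. t *\<^sub>R (y - x))) (at 0)"
    unfolding c_def by (auto intro!: derivative_eq_intros)
  ultimately have "((\<lambda>t. ?f (c t)) has_derivative (\<lambda>t. (t *\<^sub>R (y - x)) \<bullet> gradient f x)) (at 0)"
    using has_derivative_compose by blast
  then have "((\<lambda>t. ?f (c t)) has_real_derivative (gradient f x \<bullet> (y - x))) (at 0)"
    by (simp add: has_field_derivative_def mult_commute_abs inner_commute)
  then have "((\<lambda>t. (?f (c t) - ?f x) / t) \<longlongrightarrow> gradient f x \<bullet> (y - x)) (at 0)"
    by (simp add: DERIV_def c_def)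
  \<comment> \<open>From the right, \<open>c t\<close> lies on the segment from \<open>x\<close> to
    \<open>y\<close>, so convexity bounds the difference quotient by its value at
    \<open>t = 1\<close>.\<close>
  then have lim: "((\<lambda>t. (?f (c t) - ?f x) / t) \<longlongrightarrow> gradient f x \<bullet> (y - x)) (at_right 0)"
    by (rule tendsto_mono[rotated]) (simp add: at_le)
  have "gradient f x \<bullet> (y - x) \<le> ?f y - ?f x"
  proof (rule tendsto_upperbound[OF lim])
    show "\<forall>\<^sub>F t in at_right 0. (?f (c t) - ?f x) / t \<le> ?f y - ?f x"
      using eventually_at_right_real[of 0 1, OF zero_less_one]
    proof eventually_elim
      case (elim t)
      have "c t = (1 - t) *\<^sub>R x + t *\<^sub>R y" by (simp add: c_def algebra_simps)
      then have "?f (c t) \<le> (1 - t) * ?f x + t * ?f y"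
        using econvex_segment(2)[OF assms(1-4), of t] elim by simp
      then show ?case using elim by (simp add: field_simps)
    qed
  qed simp
  then show ?thesis by simp
qed

section \<open>The linesearch and one forward-backward step\<close>

text \<open>The bound by 1 makes the next iterate a convex combination of \<open>x\<close> and the
  forward-backward point, and later fixes the sign of a remainder.\<close>

lemma linesearch2_output:
  assumes "linesearch2 f g x \<theta> = Some \<beta>" "0 < \<theta>" "\<theta> < 1"
  shows "0 < \<beta>" "\<beta> \<le> 1" "\<not> linesearch2_continue f g x \<beta>"
proof -
  have "0 < \<beta> \<and> \<beta> \<le> 1"
  proof (rule while_option_rule[where P = "\<lambda>b. 0 < b \<and> b \<le> 1"])
    show "while_option (linesearch2_continue f g x) (\<lambda>\<beta>. \<theta> * \<beta>) 1 = Some \<beta>"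
      using assms(1) by (simp add: linesearch2_def)
  qed (use assms in \<open>auto intro: mult_le_one\<close>)
  then show "0 < \<beta>" "\<beta> \<le> 1" by auto
  show "\<not> linesearch2_continue f g x \<beta>"
    by (rule while_option_stop[OF assms(1)[unfolded linesearch2_def]])
qed

text \<open>The exit condition of the linesearch takes the place of the descent lemma for Lipschitz
  gradients.\<close>

lemma forward_backward_step:
  fixes f g :: "'a::{real_inner, complete_space} \<Rightarrow> ereal"
  assumes f: "eproper f" "econvex f" and g: "eproper g" "lower_semicont g" "econvex g"
    and dom: "edom g \<subseteq> edom f"
    and diff: "(\<lambda>y. real_of_ereal (f y)) differentiable (at x)"
    and x: "x \<in> edom g" and \<beta>: "0 < \<beta>" "\<beta> \<le> 1"
    and stop: "\<not> linesearch2_continue f g x \<beta>"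
    and z: "z = x - \<beta> *\<^sub>R (x - fb_point f g x)"
  defines "F \<equiv> \<lambda>y. real_of_ereal (f y) + real_of_ereal (g y)"
  shows "z \<in> edom g"
    and "y \<in> edom g \<Longrightarrow>
      2 * (F z - F x) + 2 * \<beta> * (F x - F y) \<le> (norm (x - y))\<^sup>2 - (norm (z - y))\<^sup>2"
proof -
  let ?f = "\<lambda>y. real_of_ereal (f y)" and ?g = "\<lambda>y. real_of_ereal (g y)"
  define J where "J = fb_point f g x"
  define G where "G = gradient f x"
  have sub: "x - G - J \<in> subdiff g J"
    unfolding J_def G_def fb_point_def by (rule prox_subdiff[OF g])
  have J: "J \<in> edom g" by (rule subdiff_edom[OF g(1) sub])
  have "z = (1 - \<beta>) *\<^sub>R x + \<beta> *\<^sub>R J" by (simp add: z J_def algebra_simps)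
  then show zd: "z \<in> edom g"
    using econvex_segment(1)[OF g(1,3) x J less_imp_le[OF \<beta>(1)] \<beta>(2)] by (simp only:)
  have fin: "f w = ereal (?f w)" "g w = ereal (?g w)" if "w \<in> edom g" for w
    using eproper_ereal_real[OF f(1), of w] eproper_ereal_real[OF g(1) that] dom that by auto
  have "f z + g z \<le> (f x + g x) - ereal \<beta> * (g x - g J)
      - ereal (\<beta> * (G \<bullet> (x - J))) + ereal (\<beta> / 2 * (norm (x - J))\<^sup>2)"
    using stop unfolding linesearch2_continue_def Let_def J_def[symmetric] G_def[symmetric]
    unfolding z J_def[symmetric] by (simp only: not_less)
  moreover obtain fx gx gJ fz gz where
    "f x = ereal fx" "g x = ereal gx" "g J = ereal gJ" "f z = ereal fz" "g z = ereal gz"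
    using fin[OF x] fin[OF J] fin[OF zd] by blast
  ultimately have "ereal (F z) \<le> ereal (F x - \<beta> * (?g x - ?g J)
      - \<beta> * (G \<bullet> (x - J)) + \<beta> / 2 * (norm (x - J))\<^sup>2)"
    by (simp add: F_def)
  then have dec: "F z \<le> F x - \<beta> * (?g x - ?g J)
      - \<beta> * (G \<bullet> (x - J)) + \<beta> / 2 * (norm (x - J))\<^sup>2"
    by simp
  assume y: "y \<in> edom g"
  have "?g J + (x - G - J) \<bullet> (y - J) \<le> ?g y" by (rule subdiff_real_le[OF g(1) sub y])
  moreover have "?f x + G \<bullet> (y - x) \<le> ?f y"
    unfolding G_def by (rule gradient_inequality) (use f dom x y diff in auto)
  \<comment> \<open>Both inequalities are tested at the same \<open>y\<close>, so the gradient terms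
    collapse to \<open>G \<bullet> (x - J)\<close>. The right-hand side is the quantity that
    \<open>dec\<close> scales by \<beta>.\<close>
  ultimately have "F x - F y + (x - J) \<bullet> (y - J) \<le> ?g x - ?g J + G \<bullet> (x - J)"
    unfolding F_def by (simp add: inner_diff_left inner_diff_right)
  then have "\<beta> * (F x - F y + (x - J) \<bullet> (y - J)) \<le> \<beta> * (?g x - ?g J + G \<bullet> (x - J))"
    using \<beta> by simp
  then have 1: "2 * (F z - F x) + 2 * \<beta> * (F x - F y)
      \<le> \<beta> * ((norm (x - J))\<^sup>2 - 2 * ((x - J) \<bullet> (y - J)))"
    using dec by (simp add: algebra_simps)
  \<comment> \<open>Expanding everything in \<open>x - y\<close> and \<open>x - J\<close> shows that
    the bound in \<open>1\<close> misses the difference of squared distances only by a term that is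
    nonnegative because \<beta> is at most 1.\<close>
  have "(norm (x - y))\<^sup>2 - (norm (z - y))\<^sup>2
      = \<beta> * ((norm (x - J))\<^sup>2 - 2 * ((x - J) \<bullet> (y - J))) + \<beta> * (1 - \<beta>) * (norm (x - J))\<^sup>2"
  proof -
    have "z - y = (x - y) - \<beta> *\<^sub>R (x - J)" "y - J = (x - J) - (x - y)"
      by (simp_all add: z J_def)
    then show ?thesis
      unfolding power2_norm_eq_inner
      by (simp only: inner_diff_left[of "x - y"] inner_diff_right[of _ "x - y"]
          inner_diff_right[of _ "x - J" "x - y"] inner_scaleR_left inner_scaleR_right
          inner_commute[of "x - y" "x - J"]) (simp add: algebra_simps)
  qed
  moreover have "\<beta> * (1 - \<beta>) * (norm (x - J))\<^sup>2 \<ge> 0" using \<beta> by simp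
  ultimately show "2 * (F z - F x) + 2 * \<beta> * (F x - F y) \<le> (norm (x - y))\<^sup>2 - (norm (z - y))\<^sup>2"
    using 1 by linarith
qed

section \<open>Rates from summability of the gaps\<close>

text \<open>The block of indices from \<open>n div 2\<close> up to \<open>n\<close> has at least
  \<open>n / 2\<close> terms, each at least \<open>a n\<close>, and its sum is small by the Cauchy
  criterion.\<close>

lemma decseq_summable_imp_mult_tendsto_0:
  fixes a :: "nat \<Rightarrow> real"
  assumes "decseq a" "\<And>n. 0 \<le> a n" "summable a"
  shows "(\<lambda>n. real n * a n) \<longlonglongrightarrow> 0"
proof (rule LIMSEQ_I)
  fix e :: real assume e: "e > 0"
  obtain N where N: "\<And>m n. m \<ge> N \<Longrightarrow> norm (sum a {m..<n}) < e / 2"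
    using assms(3) e unfolding summable_Cauchy by (metis half_gt_zero)
  show "\<exists>n0. \<forall>n\<ge>n0. norm (real n * a n - 0) < e"
  proof (intro exI allI impI)
    \<comment> \<open>The threshold \<open>2 * N\<close> ensures that the block starts no earlier
      than \<open>N\<close>.\<close>
    fix n assume n: "n \<ge> 2 * N"
    have "real (n - n div 2) * a n = (\<Sum>k = n div 2..<n. a n)" by simp
    also have "\<dots> \<le> sum a {n div 2..<n}"
      by (rule sum_mono) (use assms(1) in \<open>auto simp: decseq_def\<close>)
    also have "\<dots> < e / 2"
    proof -
      have "N \<le> n div 2" using n by linarith
      from N[OF this, of n] show ?thesis unfolding real_norm_def by linarith
    qed
    finally have "real (n - n div 2) * a n < e / 2" .
    moreover have "real n / 2 * a n \<le> real (n - n div 2) * a n"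
      by (intro mult_right_mono assms) linarith
    ultimately show "norm (real n * a n - 0) < e" using assms(2)[of n] by simp
  qed
qed

theorem theorem5p3:
  fixes f g :: "'a::{real_inner, complete_space} \<Rightarrow> ereal"
    and x :: "nat \<Rightarrow> 'a" and \<beta>s :: "nat \<Rightarrow> real" and \<beta> \<theta> :: real
  assumes "eproper f" "lower_semicont f" "econvex f"
    and "eproper g" "lower_semicont g" "econvex g"
    and "edom g \<subseteq> edom f"
    and "\<exists>U. edom g \<subseteq> U \<and> frechet_differentiable_on_open f U"
    and "\<And>B. B \<subseteq> edom g \<Longrightarrow> bounded B \<Longrightarrow> uniformly_continuous_on B (gradient f)"
    and "\<And>B. B \<subseteq> edom g \<Longrightarrow> bounded B \<Longrightarrow> bounded (gradient f ` B)"
    and "method2 f g \<theta> x \<beta>s"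
    and "minimizers (\<lambda>y. f y + g y) \<noteq> {}"
    and "\<beta> > 0" and "\<And>k. \<beta>s k \<ge> \<beta>"
  shows "(\<forall>k\<ge>1.
            (f (x k) + g (x k)) - (INF y. f y + g y)
              \<le> ereal (1 / (2 * \<beta>)) *
                 ((ereal ((infdist (x 0) (minimizers (\<lambda>y. f y + g y)))\<^sup>2)
                    + 2 * ((f (x 0) + g (x 0)) - (INF y. f y + g y))) / ereal (real k)))
         \<and> ((\<exists>B::'a set. finite B \<and> span B = UNIV) \<longrightarrow>
              (\<lambda>k. ereal (real k) * ((f (x k) + g (x k)) - (INF y. f y + g y)))
                \<longlonglongrightarrow> 0)"
proof -
  define F where "F y = real_of_ereal (f y) + real_of_ereal (g y)" for y
  let ?S = "minimizers (\<lambda>y. f y + g y)"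
  have F: "f y + g y = ereal (F y)" if "y \<in> edom g" for y
    using eproper_ereal_real[OF assms(1), of y] eproper_ereal_real[OF assms(4), of y] assms(7) that
    unfolding F_def by (metis plus_ereal.simps(1) subsetD)
  have diff: "(\<lambda>y. real_of_ereal (f y)) differentiable (at y)" if "y \<in> edom g" for y
    using assms(8) that unfolding frechet_differentiable_on_open_def by blast
  have \<theta>: "0 < \<theta>" "\<theta> < 1" and x0: "x 0 \<in> edom g"
    and ls: "\<And>k. linesearch2 f g (x k) \<theta> = Some (\<beta>s k)"
    and xSuc: "\<And>k. x (Suc k) = x k - \<beta>s k *\<^sub>R (x k - fb_point f g (x k))"
    using assms(11) unfolding method2_def by auto
  \<comment> \<open>Membership of \<open>x k\<close> in \<open>edom g\<close> remains a premise,
    once through \<open>diff\<close> and once directly, so that \<open>xdom\<close> can be proved by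
    induction from \<open>step(1)\<close>.\<close>
  note step = forward_backward_step[OF assms(1,3,4,5,6,7) diff _
      linesearch2_output[OF ls \<theta>] xSuc, folded F_def]
  have xdom: "x k \<in> edom g" for k
    by (induction k) (use x0 step(1) in auto)
  have key: "2 * (F (x (Suc k)) - F (x k)) + 2 * \<beta>s k * (F (x k) - F y)
      \<le> (norm (x k - y))\<^sup>2 - (norm (x (Suc k) - y))\<^sup>2" if "y \<in> edom g" for k y
    by (rule step(2)[OF xdom xdom that])
  have dec: "F (x (Suc k)) \<le> F (x k)" for k
  proof -
    have "2 * F (x (Suc k)) - 2 * F (x k) \<le> - (norm (x (Suc k) - x k))\<^sup>2"
      using key[OF xdom, of k k] by simp
    then show ?thesis using zero_le_power2[of "norm (x (Suc k) - x k)"] by linarith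
  qed
  \<comment> \<open>Any minimizer will do: \<open>S(2)\<close> identifies its value with the
    infimum.\<close>
  define m where "m = F (SOME s. s \<in> ?S)"
  have S: "s \<in> edom g" "(INF y. f y + g y) = ereal (F s)" if "s \<in> ?S" for s
  proof -
    have le: "f s + g s \<le> f y + g y" for y using that by (simp add: minimizers_def)
    have "f s + g s \<le> ereal (F (x 0))" using le[of "x 0"] F[OF x0] by simp
    then show sd: "s \<in> edom g"
      using assms(1) by (cases "f s"; cases "g s") (auto simp: eproper_def edom_def)
    have "(INF y. f y + g y) = f s + g s"
      by (rule antisym) (auto intro: INF_lower INF_greatest le)
    then show "(INF y. f y + g y) = ereal (F s)" using F[OF sd] by simp
  qed
  have INF: "(INF y. f y + g y) = ereal m"
    unfolding m_def by (rule S(2)) (use assms(12) some_in_eq in blast)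
  define a where "a k = F (x k) - m" for k
  have gap: "(f (x k) + g (x k)) - (INF y. f y + g y) = ereal (a k)" for k
    by (simp add: F[OF xdom] INF a_def)
  have a0: "0 \<le> a k" for k
    using INF_lower[of "x k" UNIV "\<lambda>y. f y + g y"] unfolding INF F[OF xdom] a_def by simp
  have adec: "decseq a" using dec by (auto simp: a_def intro: decseq_SucI)
  have sum: "2 * \<beta> * (\<Sum>k<n. a k) \<le> (norm (x 0 - s))\<^sup>2 + 2 * a 0" if s: "s \<in> ?S" for n s
  proof -
    have Fs: "F s = m" using S(2)[OF s] INF by simp
    \<comment> \<open>The induction keeps \<open>2 * a n\<close> and the squared distance, which are
      the telescoping terms; both are nonnegative and dropped only afterwards.\<close>
    have "2 * \<beta> * (\<Sum>k<n. a k) + 2 * a n + (norm (x n - s))\<^sup>2 \<le> (norm (x 0 - s))\<^sup>2 + 2 * a 0"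
    proof (induction n)
      case (Suc n)
      have "2 * (a (Suc n) - a n) + 2 * \<beta>s n * a n
          \<le> (norm (x n - s))\<^sup>2 - (norm (x (Suc n) - s))\<^sup>2"
        using key[OF S(1)[OF s], of n] by (simp add: a_def Fs)
      moreover have "2 * \<beta> * a n \<le> 2 * \<beta>s n * a n"
        using assms(14)[of n] a0[of n] by (simp add: mult_right_mono)
      moreover have "2 * \<beta> * (\<Sum>k<Suc n. a k) = 2 * \<beta> * (\<Sum>k<n. a k) + 2 * \<beta> * a n"
        by (simp add: distrib_left)
      ultimately show ?case using Suc.IH by argo
    qed simp
    then show ?thesis using a0[of n] zero_le_power2[of "norm (x n - s)"] by linarith
  qed
  have bound: "2 * \<beta> * (real n * a n) \<le> (infdist (x 0) ?S)\<^sup>2 + 2 * a 0" for n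
  proof -
    \<comment> \<open>\<open>infdist\<close> is an infimum of distances rather than of their
      squares, so the infimum over minimizers is taken after a square root. A negative
      \<open>c\<close> does no harm, as \<open>sqrt\<close> is odd and monotone on all
      reals.\<close>
    define c where "c = 2 * \<beta> * (real n * a n) - 2 * a 0"
    \<comment> \<open>The sum has \<open>n\<close> terms with indices below \<open>n\<close>, each
      at least \<open>a n\<close> by monotonicity; this gives the rate at index \<open>n\<close>
      itself.\<close>
    have "real n * a n \<le> (\<Sum>k<n. a k)"
      using sum_bounded_below[of "{..<n}" "a n" a] adec by (simp add: decseq_def)
    then have "2 * \<beta> * (real n * a n) \<le> 2 * \<beta> * (\<Sum>k<n. a k)" using assms(13) by simp
    then have "sqrt c \<le> dist (x 0) s" if "s \<in> ?S" for s
      using sum[OF that, of n] by (intro real_le_lsqrt) (auto simp: c_def dist_norm)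
    then have "sqrt c \<le> infdist (x 0) ?S"
      using assms(12) unfolding infdist_def by (auto intro: cINF_greatest)
    then show ?thesis using sqrt_le_D unfolding c_def by fastforce
  qed
  have "summable a"
  proof -
    obtain s where s: "s \<in> ?S" using assms(12) by blast
    show ?thesis
    proof (rule summableI_nonneg_bounded[OF a0])
      show "(\<Sum>k<n. a k) \<le> ((norm (x 0 - s))\<^sup>2 + 2 * a 0) / (2 * \<beta>)" for n
        using sum[OF s, of n] assms(13) by (simp add: field_simps)
    qed
  qed
  then have lim: "(\<lambda>k. real k * a k) \<longlonglongrightarrow> 0"
    by (rule decseq_summable_imp_mult_tendsto_0[OF adec a0])
  have "ereal (a k) \<le> ereal (1 / (2 * \<beta>))
      * ((ereal ((infdist (x 0) ?S)\<^sup>2) + 2 * ereal (a 0)) / ereal (real k))" if "k \<ge> 1" for k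
  proof -
    have "ereal (1 / (2 * \<beta>)) * ((ereal ((infdist (x 0) ?S)\<^sup>2) + 2 * ereal (a 0)) / ereal (real k))
        = ereal (1 / (2 * \<beta>) * (((infdist (x 0) ?S)\<^sup>2 + 2 * a 0) / real k))"
      using that by (simp add: numeral_eq_ereal)
    moreover have "a k \<le> 1 / (2 * \<beta>) * (((infdist (x 0) ?S)\<^sup>2 + 2 * a 0) / real k)"
      using bound[of k] that assms(13) by (simp add: field_simps)
    ultimately show ?thesis by simp
  qed
  moreover have "(\<lambda>k. ereal (real k) * ereal (a k)) \<longlonglongrightarrow> 0"
    using lim by (simp add: zero_ereal_def)
  ultimately show ?thesis unfolding gap by blast
qed

end
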